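(* Let $\mathcal{C},\mathcal{D}$ be small connected categories and let $F,G\colon\mathcal{C}\to\mathcal{D}$ be two functors. Then $$\mathrm{cD}(F,G)\le \mathrm{ccat}(\mathcal{C}).$$
   Context: Interval category: for $m\ge 0$, $\mathcal{I}_m$ has objects $0,1,\dots,m$ and its only non-identity arrows are: exactly one arrow $r\to s$ whenever $r$ is even and $s=r-1$ or $s=r+1$. Two functors $F,G\colon\mathcal{C}\to\mathcal{D}$ between small categories are homotopic, $F\simeq G$, if for some $m\ge 0$ there is a functor $H\colon\mathcal{C}\times\mathcal{I}_m\to\mathcal{D}$ with $H_0=F$ and $H_m=G$ (equivalently, $F$ and $G$ are joined by a finite zigzag of natural transformations). A small category is connected if any two objects are joined by a finite zigzag of arrows. Members of covers (subcategories) are not required to be connected. Geometric cover: a collection $\{\mathcal{U}_\lambda\}_{\lambda\in\Lambda}$ of subcategories of $\mathcal{C}$ such that for every sequence of composable arrows $f_1,\dots,f_n$ in $\mathcal{C}$ there is $\lambda\in\Lambda$ such that every $f_i$ belongs to $\mathcal{U}_\lambda$. Categorical homotopic distance: for functors $F,G\colon\mathcal{C}\to\mathcal{D}$, $\mathrm{cD}(F,G)$ is the least integer $n\ge 0$ such that there is a geometric cover $\{\mathcal{U}_0,\dots,\mathcal{U}_n\}$ of $\mathcal{C}$ with $F_{|\mathcal{U}_j}\simeq G_{|\mathcal{U}_j}$ for all $j$; it is $\infty$ if there is no such cover. Categorical LS-category: a subcategory $\mathcal{U}$ of $\mathcal{C}$ is categorical in $\mathcal{C}$ if the inclusion functor $\mathcal{U}\to\mathcal{C}$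 is homotopic to a constant functor onto an object (every object goes to that object, every arrow to its identity). $\mathrm{ccat}(\mathcal{C})$ is the least integer $n\ge 0$ such that $\mathcal{C}$ has a geometric cover formed by $n+1$ categorical subcategories, and $\infty$ if there is none. *)

theory Defs
  imports Main "HOL-Library.Extended_Nat"
begin

section \<open>Small categories\<close>

record ('o, 'a) cat =
  Obj :: "'o set"
  Arr :: "'a set"
  Dom :: "'a \<Rightarrow> 'o"
  Cod :: "'a \<Rightarrow> 'o"
  Ide :: "'o \<Rightarrow> 'a"
  Cmp :: "'a \<Rightarrow> 'a \<Rightarrow> 'a"

text \<open>\<open>Cmp C g f\<close> is the composite ``first \<open>f\<close>, then \<open>g\<close>''. It is meaningful only if
  \<open>Cod C f = Dom C g\<close>; no operation is constrained outside its domain.\<close>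

locale category =
  fixes C :: "('o, 'a) cat"
  assumes Dom_in: "f \<in> Arr C \<Longrightarrow> Dom C f \<in> Obj C"
    and Cod_in: "f \<in> Arr C \<Longrightarrow> Cod C f \<in> Obj C"
    and Ide_in: "x \<in> Obj C \<Longrightarrow> Ide C x \<in> Arr C"
    and Dom_Ide: "x \<in> Obj C \<Longrightarrow> Dom C (Ide C x) = x"
    and Cod_Ide: "x \<in> Obj C \<Longrightarrow> Cod C (Ide C x) = x"
    and Cmp_in: "\<lbrakk>f \<in> Arr C; g \<in> Arr C; Cod C f = Dom C g\<rbrakk> \<Longrightarrow> Cmp C g f \<in> Arr C"
    and Dom_Cmp: "\<lbrakk>f \<in> Arr C; g \<in> Arr C; Cod C f = Dom C g\<rbrakk> \<Longrightarrow> Dom C (Cmp C g f) = Dom C f"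
    and Cod_Cmp: "\<lbrakk>f \<in> Arr C; g \<in> Arr C; Cod C f = Dom C g\<rbrakk> \<Longrightarrow> Cod C (Cmp C g f) = Cod C g"
    and Cmp_Ide_right: "f \<in> Arr C \<Longrightarrow> Cmp C f (Ide C (Dom C f)) = f"
    and Cmp_Ide_left: "f \<in> Arr C \<Longrightarrow> Cmp C (Ide C (Cod C f)) f = f"
    and Cmp_assoc: "\<lbrakk>f \<in> Arr C; g \<in> Arr C; h \<in> Arr C; Cod C f = Dom C g; Cod C g = Dom C h\<rbrakk>
      \<Longrightarrow> Cmp C h (Cmp C g f) = Cmp C (Cmp C h g) f"

definition arrow_rel :: "('o, 'a) cat \<Rightarrow> ('o \<times> 'o) set" where
  "arrow_rel C = {(Dom C f, Cod C f) | f. f \<in> Arr C}"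

definition connected_cat :: "('o, 'a) cat \<Rightarrow> bool" where
  "connected_cat C \<longleftrightarrow>
    (\<forall>x\<in>Obj C. \<forall>y\<in>Obj C. (x, y) \<in> (arrow_rel C \<union> (arrow_rel C)\<inverse>)\<^sup>*)"

definition subcategory :: "('o, 'a) cat \<Rightarrow> ('o, 'a) cat \<Rightarrow> bool" where
  "subcategory U C \<longleftrightarrow>
    category U \<and> Obj U \<subseteq> Obj C \<and> Arr U \<subseteq> Arr C \<and>
    (\<forall>f\<in>Arr U. Dom U f = Dom C f \<and> Cod U f = Cod C f) \<and>
    (\<forall>x\<in>Obj U. Ide U x = Ide C x) \<and>
    (\<forall>f\<in>Arr U. \<forall>g\<in>Arr U. Cod U f = Dom U g \<longrightarrow> Cmp U g f = Cmp C g f)"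

definition prod_cat :: "('o, 'a) cat \<Rightarrow> ('p, 'b) cat \<Rightarrow> ('o \<times> 'p, 'a \<times> 'b) cat" where
  "prod_cat C D =
    \<lparr> Obj = Obj C \<times> Obj D,
      Arr = Arr C \<times> Arr D,
      Dom = (\<lambda>(f, g). (Dom C f, Dom D g)),
      Cod = (\<lambda>(f, g). (Cod C f, Cod D g)),
      Ide = (\<lambda>(x, y). (Ide C x, Ide D y)),
      Cmp = (\<lambda>(f', g') (f, g). (Cmp C f' f, Cmp D g' g)) \<rparr>"

text \<open>The arrow \<open>r \<rightarrow> s\<close> is the pair \<open>(r, s)\<close>, identities being the pairs \<open>(r, r)\<close>. Two
  composable arrows are never both non-identities, since a non-identity arrow goes from an
  even to an odd number. The condition \<open>r = s + 1\<close> avoids truncated subtraction.\<close>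

definition interval_cat :: "nat \<Rightarrow> (nat, nat \<times> nat) cat" where
  "interval_cat m =
    \<lparr> Obj = {0..m},
      Arr = {(r, s). r \<le> m \<and> s \<le> m \<and> (r = s \<or> even r \<and> (s = r + 1 \<or> r = s + 1))},
      Dom = fst,
      Cod = snd,
      Ide = (\<lambda>r. (r, r)),
      Cmp = (\<lambda>g f. (fst f, snd g)) \<rparr>"

lemma category_prod_cat:
  assumes "category C" and "category D"
  shows "category (prod_cat C D)"
  using assms unfolding category_def prod_cat_def by auto

lemma category_interval_cat: "category (interval_cat m)"
  unfolding category_def interval_cat_def by auto

section \<open>Functors and homotopies\<close>

text \<open>A functor is a pair of total functions of which only the values on the source category
  matter, so equality of functors is equality on the objects and arrows of the source. In
  particular the restriction of \<open>F\<close> to a subcategory \<open>U\<close> is \<open>F\<close> itself, read as a functor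
  on \<open>U\<close>.\<close>

record ('o, 'a, 'p, 'b) fctr =
  fobj :: "'o \<Rightarrow> 'p"
  farr :: "'a \<Rightarrow> 'b"

locale is_functor = source: category C + target: category D
  for C :: "('o, 'a) cat" and D :: "('p, 'b) cat" +
  fixes F :: "('o, 'a, 'p, 'b) fctr"
  assumes fobj_in: "x \<in> Obj C \<Longrightarrow> fobj F x \<in> Obj D"
    and farr_in: "f \<in> Arr C \<Longrightarrow> farr F f \<in> Arr D"
    and Dom_farr: "f \<in> Arr C \<Longrightarrow> Dom D (farr F f) = fobj F (Dom C f)"
    and Cod_farr: "f \<in> Arr C \<Longrightarrow> Cod D (farr F f) = fobj F (Cod C f)"
    and farr_Ide: "x \<in> Obj C \<Longrightarrow> farr F (Ide C x) = Ide D (fobj F x)"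
    and farr_Cmp: "\<lbrakk>f \<in> Arr C; g \<in> Arr C; Cod C f = Dom C g\<rbrakk>
      \<Longrightarrow> farr F (Cmp C g f) = Cmp D (farr F g) (farr F f)"

definition functor_eq ::
  "('o, 'a) cat \<Rightarrow> ('o, 'a, 'p, 'b) fctr \<Rightarrow> ('o, 'a, 'p, 'b) fctr \<Rightarrow> bool" where
  "functor_eq C F G \<longleftrightarrow>
    (\<forall>x\<in>Obj C. fobj F x = fobj G x) \<and> (\<forall>f\<in>Arr C. farr F f = farr G f)"

definition inclusion_functor :: "('o, 'a, 'o, 'a) fctr" where
  "inclusion_functor = \<lparr> fobj = (\<lambda>x. x), farr = (\<lambda>f. f) \<rparr>"

definition const_functor :: "('p, 'b) cat \<Rightarrow> 'p \<Rightarrow> ('o, 'a, 'p, 'b) fctr" where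
  "const_functor D d = \<lparr> fobj = (\<lambda>_. d), farr = (\<lambda>_. Ide D d) \<rparr>"

text \<open>The functor \<open>H\<^sub>i\<close> on \<open>C\<close> induced by a functor \<open>H\<close> on \<open>C \<times> I\<^sub>m\<close>.\<close>

definition level ::
  "('o \<times> nat, 'a \<times> (nat \<times> nat), 'p, 'b) fctr \<Rightarrow> nat \<Rightarrow> ('o, 'a, 'p, 'b) fctr" where
  "level H i = \<lparr> fobj = (\<lambda>x. fobj H (x, i)), farr = (\<lambda>f. farr H (f, (i, i))) \<rparr>"

definition homotopic_functors ::
  "('o, 'a) cat \<Rightarrow> ('p, 'b) cat \<Rightarrow>
    ('o, 'a, 'p, 'b) fctr \<Rightarrow> ('o, 'a, 'p, 'b) fctr \<Rightarrow> bool" where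
  "homotopic_functors C D F G \<longleftrightarrow>
    (\<exists>m H. is_functor (prod_cat C (interval_cat m)) D H \<and>
      functor_eq C (level H 0) F \<and> functor_eq C (level H m) G)"

section \<open>Geometric covers, homotopic distance and LS-category\<close>

definition composable :: "('o, 'a) cat \<Rightarrow> 'a list \<Rightarrow> bool" where
  "composable C fs \<longleftrightarrow>
    fs \<noteq> [] \<and> set fs \<subseteq> Arr C \<and>
    (\<forall>i. Suc i < length fs \<longrightarrow> Cod C (fs ! i) = Dom C (fs ! Suc i))"

definition geometric_cover ::
  "('o, 'a) cat \<Rightarrow> 'i set \<Rightarrow> ('i \<Rightarrow> ('o, 'a) cat) \<Rightarrow> bool" where
  "geometric_cover C \<Lambda> U \<longleftrightarrow>
    (\<forall>l\<in>\<Lambda>. subcategory (U l) C) \<and>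
    (\<forall>fs. composable C fs \<longrightarrow> (\<exists>l\<in>\<Lambda>. set fs \<subseteq> Arr (U l)))"

text \<open>The infimum of a nonempty set in \<^typ>\<open>enat\<close> is its least element, and
  \<open>Inf {} = \<infinity>\<close>.\<close>

definition cD ::
  "('o, 'a) cat \<Rightarrow> ('p, 'b) cat \<Rightarrow>
    ('o, 'a, 'p, 'b) fctr \<Rightarrow> ('o, 'a, 'p, 'b) fctr \<Rightarrow> enat" where
  "cD C D F G =
    Inf {enat n | n. \<exists>U. geometric_cover C {0..n} U \<and>
      (\<forall>j\<in>{0..n}. homotopic_functors (U j) D F G)}"

definition categorical_in :: "('o, 'a) cat \<Rightarrow> ('o, 'a) cat \<Rightarrow> bool" where
  "categorical_in U C \<longleftrightarrow>
    subcategory U C \<and>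
    (\<exists>c\<in>Obj C. homotopic_functors U C inclusion_functor (const_functor C c))"

definition ccat :: "('o, 'a) cat \<Rightarrow> enat" where
  "ccat C =
    Inf {enat n | n. \<exists>U. geometric_cover C {0..n} U \<and>
      (\<forall>j\<in>{0..n}. categorical_in (U j) C)}"

end

theory Submission
  imports Defs
begin

text \<open>If \<open>U\<close> is categorical in \<open>C\<close>, the inclusion \<open>U \<rightarrow> C\<close> is homotopic to a constant functor
  at some object \<open>c\<close>. Composing that homotopy with \<open>F\<close> and with \<open>G\<close> gives, on \<open>U\<close>,
  \<open>F \<simeq> const (F c)\<close> and \<open>G \<simeq> const (G c)\<close>. A zigzag of arrows from \<open>F c\<close> to \<open>G c\<close> in the
  connected category \<open>D\<close> is a zigzag of natural transformations between the two constants, so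
  \<open>F \<simeq> G\<close> on \<open>U\<close> (\<open>homotopic_on_categorical\<close>). Hence every geometric cover that counts for
  \<open>ccat C\<close> also counts for \<open>cD C D F G\<close>, and the inequality compares two infima.

  The argument uses that homotopy is symmetric and transitive. Neither is immediate from the
  definition through \<open>C \<times> I\<^sub>m\<close>: the arrows of \<open>I\<^sub>m\<close> point away from the even numbers, so reversing
  an interval of odd length, or attaching another one to its end, does not give an interval of
  the prescribed shape. Homotopy is therefore identified with the equivalence relation generated
  by natural transformations (\<open>homotopic_iff_zigzag\<close>); wherever an arrow of a zigzag points the
  wrong way, the interval is lengthened by an identity transformation.\<close>

section \<open>Natural transformations and zigzags\<close>

definition natural_transformation ::
  "('o, 'a) cat \<Rightarrow> ('p, 'b) cat \<Rightarrow> ('o, 'a, 'p, 'b) fctr \<Rightarrow> ('o, 'a, 'p, 'b) fctr \<Rightarrow>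
    ('o \<Rightarrow> 'b) \<Rightarrow> bool" where
  "natural_transformation C D F G \<eta> \<longleftrightarrow>
    is_functor C D F \<and> is_functor C D G \<and>
    (\<forall>x\<in>Obj C. \<eta> x \<in> Arr D \<and> Dom D (\<eta> x) = fobj F x \<and> Cod D (\<eta> x) = fobj G x) \<and>
    (\<forall>f\<in>Arr C. Cmp D (\<eta> (Cod C f)) (farr F f) = Cmp D (farr G f) (\<eta> (Dom C f)))"

definition transforms_to ::
  "('o, 'a) cat \<Rightarrow> ('p, 'b) cat \<Rightarrow> ('o, 'a, 'p, 'b) fctr \<Rightarrow> ('o, 'a, 'p, 'b) fctr \<Rightarrow> bool" where
  "transforms_to C D F G \<longleftrightarrow> (\<exists>\<eta>. natural_transformation C D F G \<eta>)"

definition zigzag ::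
  "('o, 'a) cat \<Rightarrow> ('p, 'b) cat \<Rightarrow> ('o, 'a, 'p, 'b) fctr \<Rightarrow> ('o, 'a, 'p, 'b) fctr \<Rightarrow> bool" where
  "zigzag C D = (\<lambda>F G. transforms_to C D F G \<or> transforms_to C D G F)\<^sup>*\<^sup>*"

lemma transforms_to_functors:
  assumes "transforms_to C D F G"
  shows "is_functor C D F" and "is_functor C D G"
  using assms unfolding transforms_to_def natural_transformation_def by auto

lemma zigzag_step: "transforms_to C D F G \<Longrightarrow> zigzag C D F G"
  unfolding zigzag_def by (rule r_into_rtranclp) simp

lemma zigzag_trans: "zigzag C D F G \<Longrightarrow> zigzag C D G H \<Longrightarrow> zigzag C D F H"
  unfolding zigzag_def by (rule rtranclp_trans)

lemma zigzag_sym: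
  assumes "zigzag C D F G"
  shows "zigzag C D G F"
  using assms unfolding zigzag_def
proof (induction rule: rtranclp_induct)
  case (step G H)
  from step.hyps(2) have "transforms_to C D H G \<or> transforms_to C D G H" by blast
  then show ?case using step.IH by (rule converse_rtranclp_into_rtranclp)
qed simp

lemma functor_eq_transforms_to:
  assumes "is_functor C D F" and "is_functor C D G" and "functor_eq C F G"
  shows "transforms_to C D F G"
proof -
  interpret F: is_functor C D F by fact
  have "natural_transformation C D F G (\<lambda>x. Ide D (fobj F x))"
    unfolding natural_transformation_def
  proof (intro conjI ballI)
    fix f assume f: "f \<in> Arr C"
    then have "farr G f = farr F f" using assms(3) unfolding functor_eq_def by auto
    then show "Cmp D (Ide D (fobj F (Cod C f))) (farr F f) =
        Cmp D (farr G f) (Ide D (fobj F (Dom C f)))"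
      using f F.target.Cmp_Ide_left[OF F.farr_in[OF f]] F.target.Cmp_Ide_right[OF F.farr_in[OF f]]
      by (simp add: F.Dom_farr F.Cod_farr)
  next
    fix x assume x: "x \<in> Obj C"
    then have "fobj G x = fobj F x" using assms(3) unfolding functor_eq_def by auto
    then show "Ide D (fobj F x) \<in> Arr D" "Dom D (Ide D (fobj F x)) = fobj F x"
      "Cod D (Ide D (fobj F x)) = fobj G x"
      using F.fobj_in[OF x] by (simp_all add: F.target.Ide_in F.target.Dom_Ide F.target.Cod_Ide)
  qed (use assms in simp_all)
  then show ?thesis unfolding transforms_to_def by blast
qed

lemma transforms_to_refl: "is_functor C D F \<Longrightarrow> transforms_to C D F F"
  by (rule functor_eq_transforms_to) (auto simp: functor_eq_def)

section \<open>Homotopies as zigzags\<close>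

text \<open>The data of a functor on \<open>C \<times> I\<^sub>m\<close>, one level at a time: the arrow of \<open>I\<^sub>m\<close> between \<open>i\<close> and
  \<open>i + 1\<close> starts at whichever of the two is even.\<close>

definition staircase ::
  "('o, 'a) cat \<Rightarrow> ('p, 'b) cat \<Rightarrow> nat \<Rightarrow> (nat \<Rightarrow> ('o, 'a, 'p, 'b) fctr) \<Rightarrow> bool" where
  "staircase C D m K \<longleftrightarrow>
    (\<forall>i\<le>m. is_functor C D (K i)) \<and>
    (\<forall>i<m. if even i then transforms_to C D (K i) (K (Suc i))
            else transforms_to C D (K (Suc i)) (K i))"

lemma staircase_extend:
  assumes "staircase C D m K"
    and "if even m then transforms_to C D (K m) L else transforms_to C D L (K m)"
  shows "staircase C D (Suc m) (K(Suc m := L))"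
proof -
  have "is_functor C D L"
    using assms(2) transforms_to_functors[of C D "K m" L] transforms_to_functors[of C D L "K m"]
    by (simp split: if_splits)
  then show ?thesis
    using assms unfolding staircase_def by (auto simp: less_Suc_eq le_Suc_eq)
qed

text \<open>The last level of a staircase may be followed by a transformation in either direction: when
  the parity of the length asks for the other one, an identity is inserted first.\<close>

lemma zigzag_staircase:
  assumes "zigzag C D F G" and "is_functor C D F"
  shows "\<exists>m K. staircase C D m K \<and> K 0 = F \<and> K m = G"
  using assms(1) unfolding zigzag_def
proof (induction rule: rtranclp_induct)
  case base
  have "staircase C D 0 (\<lambda>_. F)" using assms(2) by (simp add: staircase_def)
  then show ?case by (intro exI[of _ 0] exI[of _ "\<lambda>_. F"]) simp
next
  case (step G L)
  then obtain m K where K: "staircase C D m K" "K 0 = F" "K m = G" by blast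
  show ?case
  proof (cases "if even m then transforms_to C D (K m) L else transforms_to C D L (K m)")
    case True
    show ?thesis
      by (rule exI[of _ "Suc m"], rule exI[of _ "K(Suc m := L)"])
        (simp del: fun_upd_apply add: staircase_extend[OF K(1) True] K(2) fun_upd_same
          fun_upd_other)
  next
    case False
    let ?K = "K(Suc m := G)"
    have G: "is_functor C D G" using K unfolding staircase_def by auto
    have "staircase C D (Suc m) ?K"
      by (rule staircase_extend[OF K(1)]) (simp add: K(3) transforms_to_refl[OF G])
    then have "staircase C D (Suc (Suc m)) (?K(Suc (Suc m) := L))"
      by (rule staircase_extend) (use False step.hyps(2) K(3) in \<open>auto split: if_splits\<close>)
    then show ?thesis
      by (intro exI[of _ "Suc (Suc m)"] exI[of _ "?K(Suc (Suc m) := L)"])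
        (simp del: fun_upd_apply add: K(2) fun_upd_same fun_upd_other)
  qed
qed

text \<open>An arrow \<open>(f, r \<rightarrow> s)\<close> of the product is sent to the diagonal of a naturality square. Of two
  composable arrows of \<open>I\<^sub>m\<close> at least one is an identity, so a composite meets at most one of the
  chosen transformations, and functoriality reduces to its naturality.\<close>

lemma staircase_functor:
  assumes "category C" and "category D" and "staircase C D m K"
  obtains H where "is_functor (prod_cat C (interval_cat m)) D H"
    and "\<And>i. i \<le> m \<Longrightarrow> functor_eq C (level H i) (K i)"
proof -
  interpret C: category C by fact
  interpret D: category D by fact
  have K: "is_functor C D (K i)" if "i \<le> m" for i
    using assms(3) that unfolding staircase_def by auto
  have ex: "transforms_to C D (K r) (K s)" if "(r, s) \<in> Arr (interval_cat m)" "r \<noteq> s" for r s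
  proof -
    from that consider "even r" "s = Suc r" "r < m" | "odd s" "r = Suc s" "s < m"
      by (auto simp: interval_cat_def)
    then show ?thesis using assms(3) unfolding staircase_def by cases auto
  qed
  define \<eta> where "\<eta> r s = (SOME e. natural_transformation C D (K r) (K s) e)" for r s
  have nat: "natural_transformation C D (K r) (K s) (\<eta> r s)"
    if "(r, s) \<in> Arr (interval_cat m)" "r \<noteq> s" for r s
    using ex[OF that] unfolding \<eta>_def transforms_to_def by (rule someI_ex)
  have \<eta>_in: "\<eta> r s x \<in> Arr D" and \<eta>_Dom: "Dom D (\<eta> r s x) = fobj (K r) x"
    and \<eta>_Cod: "Cod D (\<eta> r s x) = fobj (K s) x"
    if "(r, s) \<in> Arr (interval_cat m)" "r \<noteq> s" "x \<in> Obj C" for r s x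
    using nat[OF that(1,2)] that(3) unfolding natural_transformation_def by auto
  have square: "Cmp D (\<eta> r s (Cod C f)) (farr (K r) f) = Cmp D (farr (K s) f) (\<eta> r s (Dom C f))"
    if "(r, s) \<in> Arr (interval_cat m)" "r \<noteq> s" "f \<in> Arr C" for r s f
    using nat[OF that(1,2)] that(3) unfolding natural_transformation_def by auto
  define H where "H = \<lparr> fobj = (\<lambda>(x, i). fobj (K i) x),
    farr = (\<lambda>(f, r, s). if r = s then farr (K r) f
                        else Cmp D (\<eta> r s (Cod C f)) (farr (K r) f)) \<rparr>"
  have le: "r \<le> m" "s \<le> m" if "(r, s) \<in> Arr (interval_cat m)" for r s
    using that by (auto simp: interval_cat_def)
  note Kf = is_functor.fobj_in[OF K] is_functor.farr_in[OF K] is_functor.Dom_farr[OF K]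
    is_functor.Cod_farr[OF K] is_functor.farr_Ide[OF K]
  note Kc = is_functor.farr_Cmp[OF K]
  note arr = Kf \<eta>_in \<eta>_Dom \<eta>_Cod C.Dom_in C.Cod_in D.Cmp_in D.Dom_Cmp D.Cod_Cmp
    C.Cmp_in C.Dom_Cmp C.Cod_Cmp
  have Hin: "farr H (f, r, s) \<in> Arr D \<and> Dom D (farr H (f, r, s)) = fobj (K r) (Dom C f) \<and>
      Cod D (farr H (f, r, s)) = fobj (K s) (Cod C f)"
    if "f \<in> Arr C" "(r, s) \<in> Arr (interval_cat m)" for f r s
    using that le[OF that(2)] by (auto simp: H_def arr)
  have Hcmp: "farr H (Cmp C g f, r, t) = Cmp D (farr H (g, s, t)) (farr H (f, r, s))"
    if f: "f \<in> Arr C" and g: "g \<in> Arr C" and fg: "Cod C f = Dom C g"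
      and rs: "(r, s) \<in> Arr (interval_cat m)" and st: "(s, t) \<in> Arr (interval_cat m)"
    for f g r s t
  proof -
    from rs st consider "r = s" "s = t" | "r = s" "s \<noteq> t" | "r \<noteq> s" "s = t"
      by (auto simp: interval_cat_def)
    then show ?thesis
    proof cases
      case 1
      then show ?thesis using f g fg le[OF rs] by (simp add: H_def Kc)
    next
      case 2
      then show ?thesis
        using f g fg le[OF rs] le[OF st] st
        by (simp add: H_def Kc arr D.Cmp_assoc)
    next
      case 3
      have "Cmp D (\<eta> r s (Cod C g)) (Cmp D (farr (K r) g) (farr (K r) f)) =
          Cmp D (Cmp D (\<eta> r s (Cod C g)) (farr (K r) g)) (farr (K r) f)"
        using 3 f g fg le[OF rs] rs by (intro D.Cmp_assoc) (simp_all add: arr)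
      also have "\<dots> = Cmp D (Cmp D (farr (K s) g) (\<eta> r s (Cod C f))) (farr (K r) f)"
        using 3 square[OF rs _ g] fg by simp
      also have "\<dots> = Cmp D (farr (K s) g) (Cmp D (\<eta> r s (Cod C f)) (farr (K r) f))"
        using 3 f g fg le[OF rs] rs by (intro D.Cmp_assoc[symmetric]) (simp_all add: arr)
      finally show ?thesis
        using 3 f g fg le[OF rs] by (simp add: H_def Kc arr)
    qed
  qed
  have "is_functor (prod_cat C (interval_cat m)) D H"
  proof (intro is_functor.intro is_functor_axioms.intro category_prod_cat
      category_interval_cat assms(1,2))
    fix p assume "p \<in> Obj (prod_cat C (interval_cat m))"
    then obtain x i where p: "p = (x, i)" "x \<in> Obj C" "i \<le> m"
      by (auto simp: prod_cat_def interval_cat_def)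
    then show "fobj H p \<in> Obj D" by (simp add: H_def Kf)
    show "farr H (Ide (prod_cat C (interval_cat m)) p) = Ide D (fobj H p)"
      using p by (simp add: H_def Kf prod_cat_def interval_cat_def)
  next
    fix p assume "p \<in> Arr (prod_cat C (interval_cat m))"
    then obtain f r s where p: "p = (f, r, s)" "f \<in> Arr C" "(r, s) \<in> Arr (interval_cat m)"
      by (auto simp: prod_cat_def)
    show "farr H p \<in> Arr D"
      and "Dom D (farr H p) = fobj H (Dom (prod_cat C (interval_cat m)) p)"
      and "Cod D (farr H p) = fobj H (Cod (prod_cat C (interval_cat m)) p)"
      using Hin[OF p(2,3)] by (simp_all add: p(1) prod_cat_def interval_cat_def)
        (simp_all add: H_def)
  next
    fix p q assume pq: "p \<in> Arr (prod_cat C (interval_cat m))"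
      "q \<in> Arr (prod_cat C (interval_cat m))"
      "Cod (prod_cat C (interval_cat m)) p = Dom (prod_cat C (interval_cat m)) q"
    then obtain f r s g t where "p = (f, r, s)" "q = (g, s, t)" "f \<in> Arr C" "g \<in> Arr C"
      "Cod C f = Dom C g" "(r, s) \<in> Arr (interval_cat m)" "(s, t) \<in> Arr (interval_cat m)"
      by (auto simp: prod_cat_def interval_cat_def)
    then show "farr H (Cmp (prod_cat C (interval_cat m)) q p) = Cmp D (farr H q) (farr H p)"
      using Hcmp by (simp add: prod_cat_def interval_cat_def)
  qed
  moreover have "functor_eq C (level H i) (K i)" for i
    by (simp add: functor_eq_def level_def H_def)
  ultimately show thesis using that by blast
qed

text \<open>Naturality of \<open>H\<close> in the interval direction: both composites around the square are
  the image of \<open>(f, r \<rightarrow> s)\<close>, factored through \<open>(f, r \<rightarrow> r)\<close> or through \<open>(f, s \<rightarrow> s)\<close>.\<close>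

lemma level_transforms_to:
  assumes "category C" and "is_functor (prod_cat C (interval_cat m)) D H"
    and rs: "(r, s) \<in> Arr (interval_cat m)"
  shows "transforms_to C D (level H r) (level H s)"
proof -
  interpret C: category C by fact
  interpret H: is_functor "prod_cat C (interval_cat m)" D H by fact
  let ?P = "prod_cat C (interval_cat m)"
  have sel: "Dom ?P (f, i, j) = (Dom C f, i)" "Cod ?P (f, i, j) = (Cod C f, j)"
    "(f, i, j) \<in> Arr ?P \<longleftrightarrow> f \<in> Arr C \<and> (i, j) \<in> Arr (interval_cat m)"
    "(x, i) \<in> Obj ?P \<longleftrightarrow> x \<in> Obj C \<and> i \<le> m"
    "Ide ?P (x, i) = (Ide C x, i, i)"
    "Cmp ?P (g, j, k) (f, i, l) = (Cmp C g f, i, k)" for f g x i j k l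
    by (auto simp: prod_cat_def interval_cat_def)
  have diag: "(i, i) \<in> Arr (interval_cat m) \<longleftrightarrow> i \<le> m" for i
    by (auto simp: interval_cat_def)
  have lm: "r \<le> m" "s \<le> m" using rs by (auto simp: interval_cat_def)
  have cmp: "Cmp D (farr H (g, j, k)) (farr H (f, i, j)) = farr H (Cmp C g f, i, k)"
    if "f \<in> Arr C" "g \<in> Arr C" "Cod C f = Dom C g"
      "(i, j) \<in> Arr (interval_cat m)" "(j, k) \<in> Arr (interval_cat m)" for f g i j k
    using H.farr_Cmp[of "(f, i, j)" "(g, j, k)"] that by (simp add: sel)
  have lev: "is_functor C D (level H i)" if "i \<le> m" for i
  proof (intro is_functor.intro is_functor_axioms.intro assms(1) H.target.category_axioms)
    fix f g assume "f \<in> Arr C" "g \<in> Arr C" "Cod C f = Dom C g"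
    then show "farr (level H i) (Cmp C g f) = Cmp D (farr (level H i) g) (farr (level H i) f)"
      using cmp[of f g i i i] that by (simp add: level_def diag)
  next
    fix x assume x: "x \<in> Obj C"
    then show "fobj (level H i) x \<in> Obj D" "farr (level H i) (Ide C x) = Ide D (fobj (level H i) x)"
      using H.fobj_in[of "(x, i)"] H.farr_Ide[of "(x, i)"] that by (simp_all add: level_def sel)
  next
    fix f assume "f \<in> Arr C"
    then show "farr (level H i) f \<in> Arr D"
      "Dom D (farr (level H i) f) = fobj (level H i) (Dom C f)"
      "Cod D (farr (level H i) f) = fobj (level H i) (Cod C f)"
      using H.farr_in[of "(f, i, i)"] H.Dom_farr[of "(f, i, i)"] H.Cod_farr[of "(f, i, i)"] that
      by (simp_all add: level_def sel diag)
  qed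
  have "natural_transformation C D (level H r) (level H s) (\<lambda>x. farr H (Ide C x, r, s))"
    unfolding natural_transformation_def
  proof (intro conjI ballI lev lm)
    fix x assume "x \<in> Obj C"
    then show "farr H (Ide C x, r, s) \<in> Arr D"
      "Dom D (farr H (Ide C x, r, s)) = fobj (level H r) x"
      "Cod D (farr H (Ide C x, r, s)) = fobj (level H s) x"
      using H.farr_in[of "(Ide C x, r, s)"] H.Dom_farr[of "(Ide C x, r, s)"]
        H.Cod_farr[of "(Ide C x, r, s)"] rs
      by (simp_all add: level_def sel C.Ide_in C.Dom_Ide C.Cod_Ide)
  next
    fix f assume f: "f \<in> Arr C"
    then have "Cmp D (farr H (Ide C (Cod C f), r, s)) (farr H (f, r, r)) = farr H (f, r, s)"
      using cmp[of f "Ide C (Cod C f)" r r s] rs lm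
      by (simp add: diag C.Cod_in C.Ide_in C.Dom_Ide C.Cmp_Ide_left)
    moreover have "Cmp D (farr H (f, s, s)) (farr H (Ide C (Dom C f), r, s)) = farr H (f, r, s)"
      using cmp[of "Ide C (Dom C f)" f r s s] rs lm f
      by (simp add: diag C.Dom_in C.Ide_in C.Cod_Ide C.Cmp_Ide_right)
    ultimately show "Cmp D (farr H (Ide C (Cod C f), r, s)) (farr (level H r) f) =
        Cmp D (farr (level H s) f) (farr H (Ide C (Dom C f), r, s))"
      by (simp add: level_def)
  qed
  then show ?thesis unfolding transforms_to_def by blast
qed

theorem homotopic_iff_zigzag:
  assumes F: "is_functor C D F" and G: "is_functor C D G"
  shows "homotopic_functors C D F G \<longleftrightarrow> zigzag C D F G"
proof
  have C: "category C" and D: "category D" using F by (auto simp: is_functor_def)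
  assume "homotopic_functors C D F G"
  then obtain m H where H: "is_functor (prod_cat C (interval_cat m)) D H"
    and ends: "functor_eq C (level H 0) F" "functor_eq C (level H m) G"
    unfolding homotopic_functors_def by blast
  note step = level_transforms_to[OF C H]
  have lev: "is_functor C D (level H i)" if "i \<le> m" for i
    using transforms_to_functors(1)[OF step[of i i]] that by (simp add: interval_cat_def)
  have "zigzag C D (level H 0) (level H i)" if "i \<le> m" for i
    using that
  proof (induction i)
    case 0
    then show ?case by (simp add: zigzag_def)
  next
    case (Suc i)
    have "zigzag C D (level H i) (level H (Suc i))"
    proof (cases "even i")
      case True
      then show ?thesis using step[of i "Suc i"] Suc.prems
        by (auto intro!: zigzag_step simp: interval_cat_def)
    next
      case False
      then show ?thesis using step[of "Suc i" i] Suc.prems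
        by (auto intro!: zigzag_sym[OF zigzag_step] simp: interval_cat_def)
    qed
    with Suc.IH Suc.prems show ?case by (auto intro: zigzag_trans)
  qed
  then have "zigzag C D (level H 0) (level H m)" by simp
  then have "zigzag C D F (level H m)"
    using zigzag_sym[OF zigzag_step[OF functor_eq_transforms_to[OF lev F ends(1)]]]
    by (auto intro: zigzag_trans)
  then show "zigzag C D F G"
    using zigzag_step[OF functor_eq_transforms_to[OF lev G ends(2)]]
    by (auto intro: zigzag_trans)
next
  have C: "category C" and D: "category D" using F by (auto simp: is_functor_def)
  assume "zigzag C D F G"
  from zigzag_staircase[OF this F] obtain m K
    where K: "staircase C D m K" "K 0 = F" "K m = G" by blast
  obtain H where H: "is_functor (prod_cat C (interval_cat m)) D H"
    and levels: "\<And>i. i \<le> m \<Longrightarrow> functor_eq C (level H i) (K i)"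
    using staircase_functor[OF C D K(1)] by blast
  show "homotopic_functors C D F G"
    unfolding homotopic_functors_def
    using H levels[of 0] levels[of m] K(2,3) by (intro exI[of _ m] exI[of _ H]) simp
qed

section \<open>Composing zigzags with a functor\<close>

definition comp_functor ::
  "('p, 'b, 'q, 'c) fctr \<Rightarrow> ('o, 'a, 'p, 'b) fctr \<Rightarrow> ('o, 'a, 'q, 'c) fctr" where
  "comp_functor F K = \<lparr> fobj = fobj F \<circ> fobj K, farr = farr F \<circ> farr K \<rparr>"

lemma is_functor_comp:
  assumes "is_functor C D F" and "is_functor U C K"
  shows "is_functor U D (comp_functor F K)"
proof -
  interpret F: is_functor C D F by fact
  interpret K: is_functor U C K by fact
  show ?thesis
    by (intro is_functor.intro is_functor_axioms.intro K.source.category_axioms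
        F.target.category_axioms)
      (simp_all add: comp_functor_def F.fobj_in F.farr_in F.Dom_farr F.Cod_farr F.farr_Ide F.farr_Cmp
        K.fobj_in K.farr_in K.Dom_farr K.Cod_farr K.farr_Ide K.farr_Cmp)
qed

lemma transforms_to_comp:
  assumes "is_functor C D F" and "transforms_to U C K L"
  shows "transforms_to U D (comp_functor F K) (comp_functor F L)"
proof -
  interpret F: is_functor C D F by fact
  from assms(2) obtain \<eta> where \<eta>: "natural_transformation U C K L \<eta>"
    unfolding transforms_to_def by blast
  interpret K: is_functor U C K using \<eta> by (simp add: natural_transformation_def)
  interpret L: is_functor U C L using \<eta> by (simp add: natural_transformation_def)
  have comp: "\<eta> x \<in> Arr C" "Dom C (\<eta> x) = fobj K x" "Cod C (\<eta> x) = fobj L x"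
    if "x \<in> Obj U" for x
    using \<eta> that by (auto simp: natural_transformation_def)
  have "natural_transformation U D (comp_functor F K) (comp_functor F L) (farr F \<circ> \<eta>)"
    unfolding natural_transformation_def
  proof (intro conjI ballI is_functor_comp[OF assms(1)] K.is_functor_axioms L.is_functor_axioms)
    fix f assume f: "f \<in> Arr U"
    then have "farr F (Cmp C (\<eta> (Cod U f)) (farr K f)) =
        farr F (Cmp C (farr L f) (\<eta> (Dom U f)))"
      using \<eta> by (simp add: natural_transformation_def)
    then show "Cmp D ((farr F \<circ> \<eta>) (Cod U f)) (farr (comp_functor F K) f) =
        Cmp D (farr (comp_functor F L) f) ((farr F \<circ> \<eta>) (Dom U f))"
      using f comp K.farr_in L.farr_in K.source.Dom_in K.source.Cod_in
      by (simp add: comp_functor_def F.farr_Cmp K.Cod_farr L.Dom_farr)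
  qed (auto simp: comp_functor_def comp F.farr_in F.Dom_farr F.Cod_farr)
  then show ?thesis unfolding transforms_to_def by blast
qed

lemma zigzag_comp:
  assumes "is_functor C D F" and "zigzag U C K L"
  shows "zigzag U D (comp_functor F K) (comp_functor F L)"
  using assms(2) unfolding zigzag_def
proof (induction rule: rtranclp_induct)
  case (step L M)
  from step.hyps(2)
  have "transforms_to U D (comp_functor F L) (comp_functor F M) \<or>
      transforms_to U D (comp_functor F M) (comp_functor F L)"
    using transforms_to_comp[OF assms(1)] by blast
  with step.IH show ?case by (rule rtranclp.rtrancl_into_rtrancl)
qed simp

lemma is_functor_inclusion: "subcategory U C \<Longrightarrow> category C \<Longrightarrow> is_functor U C inclusion_functor"
  unfolding subcategory_def inclusion_functor_def is_functor_def is_functor_axioms_def by auto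

lemma comp_functor_inclusion: "comp_functor F inclusion_functor = F"
  by (simp add: comp_functor_def inclusion_functor_def comp_def)

lemma comp_functor_const:
  assumes "is_functor C D F" and "c \<in> Obj C"
  shows "comp_functor F (const_functor C c) = const_functor D (fobj F c)"
  using is_functor.farr_Ide[OF assms]
  by (simp add: comp_functor_def const_functor_def comp_def)

section \<open>Constant functors into a connected category\<close>

lemma is_functor_const:
  assumes "category U" and "category D" and "d \<in> Obj D"
  shows "is_functor U D (const_functor D d)"
proof -
  interpret D: category D by fact
  have "Cmp D (Ide D d) (Ide D d) = Ide D d"
    using D.Cmp_Ide_left[OF D.Ide_in[OF assms(3)]] D.Cod_Ide[OF assms(3)] by simp
  then show ?thesis
    using assms by (auto simp: is_functor_def is_functor_axioms_def const_functor_def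
        D.Ide_in D.Dom_Ide D.Cod_Ide)
qed

lemma transforms_to_const:
  assumes "category U" and "category D" and f: "f \<in> Arr D"
  shows "transforms_to U D (const_functor D (Dom D f)) (const_functor D (Cod D f))"
proof -
  interpret D: category D by fact
  have "natural_transformation U D (const_functor D (Dom D f)) (const_functor D (Cod D f)) (\<lambda>_. f)"
    unfolding natural_transformation_def
    using is_functor_const[OF assms(1,2)] D.Dom_in[OF f] D.Cod_in[OF f] f
    by (auto simp: const_functor_def D.Cmp_Ide_left D.Cmp_Ide_right)
  then show ?thesis unfolding transforms_to_def by blast
qed

lemma zigzag_const:
  assumes "category U" and "category D" and "connected_cat D" and "d \<in> Obj D" and "e \<in> Obj D"
  shows "zigzag U D (const_functor D d) (const_functor D e)"
proof -
  have "(d, e) \<in> (arrow_rel D \<union> (arrow_rel D)\<inverse>)\<^sup>*"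
    using assms(3-5) unfolding connected_cat_def by blast
  then show ?thesis
  proof (induction rule: rtrancl_induct)
    case base
    then show ?case by (simp add: zigzag_def)
  next
    case (step y z)
    from step.hyps(2) have "zigzag U D (const_functor D y) (const_functor D z)"
      unfolding arrow_rel_def
      by (auto intro: zigzag_step zigzag_sym[OF zigzag_step] transforms_to_const[OF assms(1,2)])
    with step.IH show ?case by (rule zigzag_trans)
  qed
qed

section \<open>Distance and category\<close>

lemma homotopic_on_categorical:
  assumes D: "category D" "connected_cat D"
    and F: "is_functor C D F" and G: "is_functor C D G"
    and U: "categorical_in U C"
  shows "homotopic_functors U D F G"
proof -
  interpret F: is_functor C D F by fact
  interpret G: is_functor C D G by fact
  have sub: "subcategory U C" using U by (simp add: categorical_in_def)
  then have catU: "category U" by (simp add: subcategory_def)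
  note incl = is_functor_inclusion[OF sub F.source.category_axioms]
  from U obtain c where c: "c \<in> Obj C"
    and hc: "homotopic_functors U C inclusion_functor (const_functor C c)"
    unfolding categorical_in_def by blast
  have contract: "zigzag U C inclusion_functor (const_functor C c)"
    using hc homotopic_iff_zigzag[OF incl is_functor_const[OF catU F.source.category_axioms c]]
    by simp
  have to_const: "zigzag U D K (const_functor D (fobj K c))" if K: "is_functor C D K" for K
    using zigzag_comp[OF K contract] by (simp add: comp_functor_inclusion comp_functor_const[OF K c])
  have restrict: "is_functor U D K" if K: "is_functor C D K" for K
    using is_functor_comp[OF K incl] by (simp add: comp_functor_inclusion)
  have "zigzag U D F G"
    using to_const[OF F] zigzag_const[OF catU D F.fobj_in[OF c] G.fobj_in[OF c]]
      zigzag_sym[OF to_const[OF G]]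
    by (rule zigzag_trans[OF zigzag_trans])
  then show ?thesis
    using homotopic_iff_zigzag[OF restrict[OF F] restrict[OF G]] by simp
qed

theorem theorem4p8:
  fixes C :: "('o, 'a) cat" and D :: "('p, 'b) cat"
    and F G :: "('o, 'a, 'p, 'b) fctr"
  assumes "category C" and "category D"
    and "connected_cat C" and "connected_cat D"
    and "is_functor C D F" and "is_functor C D G"
  shows "cD C D F G \<le> ccat C"
  unfolding cD_def ccat_def
proof (rule Inf_superset_mono, clarify)
  fix n and U :: "nat \<Rightarrow> ('o, 'a) cat"
  assume "geometric_cover C {0..n} U" and "\<forall>j\<in>{0..n}. categorical_in (U j) C"
  moreover from this(2) have "\<forall>j\<in>{0..n}. homotopic_functors (U j) D F G"
    using homotopic_on_categorical[OF assms(2,4-6)] by simp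
  ultimately show "\<exists>n'. enat n = enat n' \<and> (\<exists>U. geometric_cover C {0..n'} U \<and>
      (\<forall>j\<in>{0..n'}. homotopic_functors (U j) D F G))"
    by (intro exI[of _ n] conjI refl exI[of _ U])
qed

end
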